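(* For every positive integer $n$, $f(f(n)+1)\le 2f(n)-n+2$, where $f(n):=R(C_4,K_{1,n})$.
   Context: Graphs are finite, simple and undirected. $G\supseteq H$ means that $H$ is isomorphic to a (not necessarily induced) subgraph of $G$; $\overline{G}$ is the complement of $G$. $C_4$ is the cycle on $4$ vertices and $K_{1,n}$ is the star on $n+1$ vertices (one center joined to $n$ leaves). The Ramsey number $R(H_1,H_2)$ is the smallest integer $N$ such that for every graph $G$ with $N$ vertices, either $G\supseteq H_1$ or $\overline{G}\supseteq H_2$. For a positive integer $n$, $f(n):=R(C_4,K_{1,n})$. *)

theory Defs
  imports Main "HOL-Library.Ramsey"
begin

text \<open>A graph is a pair of a vertex set and a set of edges, each edge being a
  two-element set of vertices.\<close>

type_synonym 'a ugraph = "'a set \<times> 'a set set"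

abbreviation verts :: "'a ugraph \<Rightarrow> 'a set" where
  "verts G \<equiv> fst G"

abbreviation edges :: "'a ugraph \<Rightarrow> 'a set set" where
  "edges G \<equiv> snd G"

definition simple_graph :: "'a ugraph \<Rightarrow> bool" where
  "simple_graph G \<longleftrightarrow> finite (verts G) \<and> edges G \<subseteq> nsets (verts G) 2"

definition complement :: "'a ugraph \<Rightarrow> 'a ugraph" where
  "complement G = (verts G, nsets (verts G) 2 - edges G)"

definition subgraph :: "'a ugraph \<Rightarrow> 'a ugraph \<Rightarrow> bool" where
  "subgraph H G \<longleftrightarrow> simple_graph H \<and> verts H \<subseteq> verts G \<and> edges H \<subseteq> edges G"

definition graph_iso :: "'a ugraph \<Rightarrow> 'b ugraph \<Rightarrow> bool" where
  "graph_iso G H \<longleftrightarrow>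
    (\<exists>\<phi>. bij_betw \<phi> (verts G) (verts H) \<and>
      (\<forall>u\<in>verts G. \<forall>v\<in>verts G. {u, v} \<in> edges G \<longleftrightarrow> {\<phi> u, \<phi> v} \<in> edges H))"

definition contains_copy :: "'a ugraph \<Rightarrow> 'b ugraph \<Rightarrow> bool" where
  "contains_copy G H \<longleftrightarrow> (\<exists>H'. subgraph H' G \<and> graph_iso H H')"

definition cycle_graph :: "nat \<Rightarrow> nat ugraph" where
  "cycle_graph n = ({0..<n}, {{i, (i + 1) mod n} | i. i < n})"

text \<open>The star with centre \<open>0\<close> and leaves \<open>1, \<dots>, n\<close>.\<close>

definition star_graph :: "nat \<Rightarrow> nat ugraph" where
  "star_graph n = ({0..n}, {{0, i} | i. i \<in> {1..n}})"

text \<open>Vertices are natural numbers here without loss of generality, since every finite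
  graph is isomorphic to one of these. The set of such \<open>N\<close> is nonempty by Ramsey's theorem
  when \<open>H\<^sub>1\<close> and \<open>H\<^sub>2\<close> are finite simple graphs, so \<open>LEAST\<close> is meaningful.\<close>

definition ramsey_number :: "'a ugraph \<Rightarrow> 'b ugraph \<Rightarrow> nat" where
  "ramsey_number H\<^sub>1 H\<^sub>2 =
    (LEAST N. \<forall>G :: nat ugraph. simple_graph G \<and> card (verts G) = N \<longrightarrow>
      contains_copy G H\<^sub>1 \<or> contains_copy (complement G) H\<^sub>2)"

definition ramsey_C4_star :: "nat \<Rightarrow> nat" where
  "ramsey_C4_star n = ramsey_number (cycle_graph 4) (star_graph n)"

end

theory Submission
  imports Defs
begin

text \<open>
  Excluding \<open>C\<^sub>4\<close> means that two distinct vertices have at most one common neighbour, and a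
  complement without \<open>K\<^bsub>1,n\<^esub>\<close> means that all degrees are large. So the Ramsey number \<open>f(n)\<close> is
  the least \<open>N\<close> such that every \<open>C\<^sub>4\<close>-free graph on \<open>N\<close> vertices has a vertex of degree
  less than \<open>N - n\<close> (lemma \<open>ramsey_C4_star_eq_Least\<close>).

  Let \<open>N = f(n)\<close> and \<open>d = N - n + 1\<close>. If the bound failed, there would be a \<open>C\<^sub>4\<close>-free graph on
  \<open>2N - n + 2 = N + d + 1\<close> vertices with minimum degree at least \<open>d\<close>. Deleting edges
  keeps it \<open>C\<^sub>4\<close>-free, so some vertex \<open>v\<close> may be assumed to have degree exactly \<open>d\<close>
  (lemma \<open>exists_spanning_subgraph_min_degree\<close>). Now remove \<open>v\<close> and its \<open>d\<close> neighbours. Exactly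
  \<open>N\<close> vertices remain, and each of them loses at most one neighbour, since its lost
  neighbours are common neighbours with \<open>v\<close>. The remaining graph is \<open>C\<^sub>4\<close>-free on \<open>N\<close> vertices
  with minimum degree at least \<open>d - 1 = N - n\<close>, contrary to the choice of \<open>N\<close>
  (lemma \<open>forces_low_degree_step\<close>).
\<close>

definition nbhd :: "'a ugraph \<Rightarrow> 'a \<Rightarrow> 'a set" where
  "nbhd G v = {u. {v, u} \<in> edges G}"

definition C4_free :: "'a ugraph \<Rightarrow> bool" where
  "C4_free G \<longleftrightarrow> (\<forall>a b. a \<noteq> b \<longrightarrow> card (nbhd G a \<inter> nbhd G b) \<le> 1)"

text \<open>The condition on \<open>v\<close> says that \<open>v\<close> has at least \<open>n\<close> non-neighbours other than itself;
  it is written as a sum to avoid truncated subtraction.\<close>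

definition forces_low_degree :: "nat \<Rightarrow> nat \<Rightarrow> bool" where
  "forces_low_degree n N \<longleftrightarrow> (\<forall>G :: nat ugraph. simple_graph G \<longrightarrow> card (verts G) = N \<longrightarrow>
     C4_free G \<longrightarrow> (\<exists>v\<in>verts G. card (nbhd G v) + n < N))"

lemma nbhd_sym: "u \<in> nbhd G v \<longleftrightarrow> v \<in> nbhd G u"
  by (simp add: nbhd_def insert_commute)

lemma simple_graph_edgeD:
  assumes "simple_graph G" "{u, v} \<in> edges G"
  shows "u \<in> verts G" "v \<in> verts G" "u \<noteq> v"
proof -
  have "{u, v} \<in> nsets (verts G) 2"
    using assms by (meson simple_graph_def subsetD)
  then show "u \<in> verts G" "v \<in> verts G" "u \<noteq> v"
    by simp_all
qed

lemma nbhd_subset: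
  assumes "simple_graph G"
  shows "nbhd G v \<subseteq> verts G - {v}"
proof
  fix u assume "u \<in> nbhd G v"
  then have "{v, u} \<in> edges G"
    by (simp add: nbhd_def)
  then show "u \<in> verts G - {v}"
    using simple_graph_edgeD[OF assms, of v u] by simp
qed

lemma finite_nbhd: "simple_graph G \<Longrightarrow> finite (nbhd G v)"
  by (meson finite_Diff finite_subset nbhd_subset simple_graph_def)

lemma simple_graph_complement: "simple_graph G \<Longrightarrow> simple_graph (complement G)"
  by (auto simp: simple_graph_def complement_def)

lemma nbhd_complement:
  assumes "v \<in> verts G"
  shows "nbhd (complement G) v = verts G - {v} - nbhd G v"
  using assms by (auto simp: nbhd_def complement_def)

lemma card_nbhd_complement:
  assumes "simple_graph G" "v \<in> verts G"
  shows "card (nbhd (complement G) v) + card (nbhd G v) + 1 = card (verts G)"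
proof -
  have fin: "finite (verts G)"
    using assms by (simp add: simple_graph_def)
  have "card (nbhd (complement G) v) + card (nbhd G v) = card (verts G - {v})"
    using nbhd_subset[OF assms(1), of v] fin
    by (metis assms(2) card_Diff_subset card_mono finite_Diff finite_subset le_add_diff_inverse2 nbhd_complement)
  then show ?thesis
    using fin assms(2) by (metis Suc_eq_plus1 card.remove)
qed

lemma C4_free_mono:
  assumes "simple_graph G" "C4_free G" "edges H \<subseteq> edges G"
  shows "C4_free H"
  unfolding C4_free_def
proof (intro allI impI)
  fix a b :: 'a
  assume "a \<noteq> b"
  have "nbhd H a \<inter> nbhd H b \<subseteq> nbhd G a \<inter> nbhd G b"
    using assms(3) by (auto simp: nbhd_def)
  then have "card (nbhd H a \<inter> nbhd H b) \<le> card (nbhd G a \<inter> nbhd G b)"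
    using assms(1) by (intro card_mono finite_Int) (auto simp: finite_nbhd)
  then show "card (nbhd H a \<inter> nbhd H b) \<le> 1"
    using assms(2) \<open>a \<noteq> b\<close> by (fastforce simp: C4_free_def)
qed

section \<open>Copies of the four-cycle and of stars\<close>

text \<open>An embedding only has to preserve edges: its image, with the images of the edges of
  \<open>H\<close> alone, is a subgraph isomorphic to \<open>H\<close>.\<close>

lemma contains_copy_iff_embedding:
  assumes G: "simple_graph G" and H: "simple_graph H"
  shows "contains_copy G H \<longleftrightarrow> (\<exists>\<phi>. inj_on \<phi> (verts H) \<and> \<phi> ` verts H \<subseteq> verts G \<and>
    (\<forall>u v. {u, v} \<in> edges H \<longrightarrow> {\<phi> u, \<phi> v} \<in> edges G))" (is "_ = (\<exists>\<phi>. ?emb \<phi>)")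
proof
  assume "contains_copy G H"
  then obtain H' \<phi> where sub: "subgraph H' G" and bij: "bij_betw \<phi> (verts H) (verts H')"
    and iso: "\<forall>u\<in>verts H. \<forall>v\<in>verts H. {u, v} \<in> edges H \<longleftrightarrow> {\<phi> u, \<phi> v} \<in> edges H'"
    by (auto simp: contains_copy_def graph_iso_def)
  have "{\<phi> u, \<phi> v} \<in> edges G" if "{u, v} \<in> edges H" for u v
    using that iso sub simple_graph_edgeD[OF H that] by (auto simp: subgraph_def)
  then have "?emb \<phi>"
    using bij sub by (auto simp: bij_betw_def subgraph_def)
  then show "\<exists>\<phi>. ?emb \<phi>" by blast
next
  assume "\<exists>\<phi>. ?emb \<phi>"
  then obtain \<phi> where emb: "?emb \<phi>" ..
  then have inj: "inj_on \<phi> (verts H)" by blast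
  define H' where "H' = (\<phi> ` verts H, (`) \<phi> ` edges H)"
  have EH: "edges H \<subseteq> nsets (verts H) 2"
    using H by (simp add: simple_graph_def)
  have "edges H' \<subseteq> nsets (verts H') 2"
  proof
    fix e assume "e \<in> edges H'"
    then obtain e0 where e0: "e0 \<in> edges H" "e = \<phi> ` e0"
      by (auto simp: H'_def)
    then have "e0 \<subseteq> verts H" "card e0 = 2" "finite e0"
      using EH by (auto simp: nsets_def)
    then show "e \<in> nsets (verts H') 2"
      using e0 inj by (auto simp: nsets_def H'_def card_image inj_on_subset)
  qed
  then have "simple_graph H'"
    using H by (simp add: simple_graph_def H'_def)
  moreover have "edges H' \<subseteq> edges G"
  proof
    fix e assume "e \<in> edges H'"
    then obtain e0 where e0: "e0 \<in> edges H" "e = \<phi> ` e0"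
      by (auto simp: H'_def)
    then have "card e0 = 2"
      using EH by (auto simp: nsets_def)
    then obtain u v where "e0 = {u, v}"
      by (auto simp: card_2_iff)
    then show "e \<in> edges G"
      using emb e0 by auto
  qed
  ultimately have "subgraph H' G"
    using emb by (simp add: subgraph_def H'_def)
  moreover have "graph_iso H H'"
    unfolding graph_iso_def
  proof (intro exI[of _ \<phi>] conjI ballI)
    show "bij_betw \<phi> (verts H) (verts H')"
      using inj by (simp add: bij_betw_def H'_def)
  next
    fix u v assume uv: "u \<in> verts H" "v \<in> verts H"
    have "inj_on ((`) \<phi>) (Pow (verts H))"
      using inj by (rule inj_on_image_Pow)
    moreover have "edges H \<subseteq> Pow (verts H)"
      using EH by (auto simp: nsets_def)
    ultimately have "\<phi> ` {u, v} \<in> (`) \<phi> ` edges H \<longleftrightarrow> {u, v} \<in> edges H"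
      using uv by (intro inj_on_image_mem_iff) auto
    then show "{u, v} \<in> edges H \<longleftrightarrow> {\<phi> u, \<phi> v} \<in> edges H'"
      by (simp add: H'_def)
  qed
  ultimately show "contains_copy G H"
    unfolding contains_copy_def by blast
qed

lemma edges_cycle_graph_4: "edges (cycle_graph 4) = {{0, 1}, {1, 2}, {2, 3}, {3, 0}}"
proof -
  have "{{i, (i + 1) mod 4} | i. i < 4} = (\<lambda>i. {i, (i + 1) mod 4}) ` {..<4::nat}"
    by auto
  also have "{..<4::nat} = {0, 1, 2, 3}"
    by auto
  finally show ?thesis
    by (simp add: cycle_graph_def flip: numeral_2_eq_2)
qed

lemma verts_cycle_graph_4: "verts (cycle_graph 4) = {0, 1, 2, 3}"
  by (auto simp: cycle_graph_def)

lemma simple_cycle_graph_4: "simple_graph (cycle_graph 4)"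
  by (auto simp: simple_graph_def edges_cycle_graph_4 verts_cycle_graph_4 nsets_def)

lemma simple_star_graph: "simple_graph (star_graph n)"
  by (auto simp: simple_graph_def star_graph_def nsets_def card_insert_if)

text \<open>Opposite vertices of a four-cycle are two vertices with two common neighbours.\<close>

lemma contains_C4_iff:
  assumes G: "simple_graph G"
  shows "contains_copy G (cycle_graph 4) \<longleftrightarrow> \<not> C4_free G"
proof
  assume "contains_copy G (cycle_graph 4)"
  then obtain \<phi> where emb: "inj_on \<phi> {0, 1, 2, 3::nat} \<and> \<phi> ` {0, 1, 2, 3} \<subseteq> verts G \<and>
      (\<forall>u v. {u, v} \<in> edges (cycle_graph 4) \<longrightarrow> {\<phi> u, \<phi> v} \<in> edges G)"
    unfolding contains_copy_iff_embedding[OF G simple_cycle_graph_4] verts_cycle_graph_4 ..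
  then have inj: "inj_on \<phi> {0, 1, 2, 3}" by (rule conjunct1)
  have E: "{\<phi> u, \<phi> v} \<in> edges G" if "{u, v} \<in> edges (cycle_graph 4)" for u v
    using emb that by simp
  have "{\<phi> 1, \<phi> 3} \<subseteq> nbhd G (\<phi> 0) \<inter> nbhd G (\<phi> 2)"
    using E[of 0 1] E[of 2 1] E[of 2 3] E[of 0 3]
    by (auto simp: nbhd_def edges_cycle_graph_4 insert_commute)
  then have "card {\<phi> 1, \<phi> 3} \<le> card (nbhd G (\<phi> 0) \<inter> nbhd G (\<phi> 2))"
    by (intro card_mono finite_Int) (simp_all add: G finite_nbhd)
  moreover have "card {\<phi> 1, \<phi> 3} = 2" "\<phi> 0 \<noteq> \<phi> 2"
    using inj by (auto simp: inj_on_def card_insert_if)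
  ultimately have "\<phi> 0 \<noteq> \<phi> 2" "\<not> card (nbhd G (\<phi> 0) \<inter> nbhd G (\<phi> 2)) \<le> 1"
    by linarith+
  then show "\<not> C4_free G"
    unfolding C4_free_def by blast
next
  assume "\<not> C4_free G"
  then obtain a b where ab: "a \<noteq> b" "2 \<le> card (nbhd G a \<inter> nbhd G b)"
    by (fastforce simp: C4_free_def)
  then obtain X where "X \<subseteq> nbhd G a \<inter> nbhd G b" "card X = 2"
    by (metis obtain_subset_with_card_n)
  then obtain x y where xy: "x \<noteq> y" and E: "{a, x} \<in> edges G" "{b, x} \<in> edges G"
      "{a, y} \<in> edges G" "{b, y} \<in> edges G"
    by (auto simp: card_2_iff nbhd_def)
  note D = simple_graph_edgeD[OF G]
  define \<phi> where "\<phi> = (\<lambda>i::nat. if i = 0 then a else if i = 1 then x else if i = 2 then b else y)"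
  have "inj_on \<phi> (verts (cycle_graph 4))" "\<phi> ` verts (cycle_graph 4) \<subseteq> verts G"
    using ab xy D[OF E(1)] D[OF E(2)] D[OF E(3)] D[OF E(4)]
    by (auto simp: verts_cycle_graph_4 \<phi>_def inj_on_def)
  moreover have "{\<phi> u, \<phi> v} \<in> edges G" if "{u, v} \<in> edges (cycle_graph 4)" for u v
    using that E by (auto simp: edges_cycle_graph_4 \<phi>_def doubleton_eq_iff insert_commute)
  ultimately show "contains_copy G (cycle_graph 4)"
    unfolding contains_copy_iff_embedding[OF G simple_cycle_graph_4] by blast
qed

lemma contains_star_iff:
  assumes G: "simple_graph G"
  shows "contains_copy G (star_graph n) \<longleftrightarrow> (\<exists>v\<in>verts G. n \<le> card (nbhd G v))"
proof
  assume "contains_copy G (star_graph n)"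
  then obtain \<phi> where emb: "inj_on \<phi> (verts (star_graph n)) \<and>
      \<phi> ` verts (star_graph n) \<subseteq> verts G \<and>
      (\<forall>u v. {u, v} \<in> edges (star_graph n) \<longrightarrow> {\<phi> u, \<phi> v} \<in> edges G)"
    unfolding contains_copy_iff_embedding[OF G simple_star_graph] ..
  then have inj: "inj_on \<phi> {0..n}" and V: "\<phi> ` {0..n} \<subseteq> verts G"
    by (simp_all add: star_graph_def)
  have E: "{\<phi> u, \<phi> v} \<in> edges G" if "{u, v} \<in> edges (star_graph n)" for u v
    using emb that by simp
  have "\<phi> ` {1..n} \<subseteq> nbhd G (\<phi> 0)"
  proof clarify
    fix i assume "i \<in> {1..n}"
    then have "{0, i} \<in> edges (star_graph n)"
      by (auto simp: star_graph_def)
    then show "\<phi> i \<in> nbhd G (\<phi> 0)"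
      unfolding nbhd_def by (simp add: E)
  qed
  moreover have "card (\<phi> ` {1..n}) = n"
    using inj by (subst card_image) (auto intro: inj_on_subset)
  ultimately have "n \<le> card (nbhd G (\<phi> 0))"
    by (metis G card_mono finite_nbhd)
  then show "\<exists>v\<in>verts G. n \<le> card (nbhd G v)"
    using V by (intro bexI[of _ "\<phi> 0"]) auto
next
  assume "\<exists>v\<in>verts G. n \<le> card (nbhd G v)"
  then obtain v where v: "v \<in> verts G" and n: "n \<le> card (nbhd G v)" by blast
  obtain X where X: "X \<subseteq> nbhd G v" "card X = n" "finite X"
    using obtain_subset_with_card_n[OF n] by metis
  then obtain h where h: "bij_betw h {1..n} X"
    using finite_same_card_bij[of "{1..n}" X] by auto
  define \<phi> where "\<phi> = (\<lambda>i. if i = 0 then v else h i)"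
  have mem: "\<phi> i \<in> nbhd G v" if "i \<in> {1..n}" for i
    using that h X by (auto simp: \<phi>_def bij_betw_def)
  have "inj_on \<phi> {1..n} \<longleftrightarrow> inj_on h {1..n}"
    by (rule inj_on_cong) (simp add: \<phi>_def)
  then have "inj_on \<phi> {1..n}"
    using h by (simp add: bij_betw_def)
  moreover have "\<phi> 0 \<notin> \<phi> ` {1..n}"
  proof -
    have "\<phi> ` {1..n} \<subseteq> nbhd G v" "v \<notin> nbhd G v"
      using mem nbhd_subset[OF G, of v] by blast+
    moreover have "\<phi> 0 = v"
      by (simp add: \<phi>_def)
    ultimately show ?thesis
      by blast
  qed
  moreover have verts: "verts (star_graph n) = insert 0 {1..n}"
    by (auto simp: star_graph_def)
  ultimately have "inj_on \<phi> (verts (star_graph n))"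
    by (simp add: inj_on_insert)
  moreover have "\<phi> ` verts (star_graph n) \<subseteq> verts G"
  proof -
    have "\<phi> ` {1..n} \<subseteq> verts G"
      using mem nbhd_subset[OF G, of v] by blast
    moreover have "\<phi> 0 \<in> verts G"
      using v by (simp add: \<phi>_def)
    ultimately show ?thesis
      by (simp add: verts)
  qed
  moreover have "{\<phi> a, \<phi> b} \<in> edges G" if ab: "{a, b} \<in> edges (star_graph n)" for a b
  proof -
    obtain i where "{a, b} = {0, i}" "i \<in> {1..n}"
      using ab by (auto simp: star_graph_def)
    then have "{\<phi> a, \<phi> b} = {v, \<phi> i}"
      by (auto simp: doubleton_eq_iff \<phi>_def)
    then show ?thesis
      using mem[OF \<open>i \<in> _\<close>] by (simp add: nbhd_def)
  qed
  ultimately show "contains_copy G (star_graph n)"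
    unfolding contains_copy_iff_embedding[OF G simple_star_graph] by blast
qed

section \<open>The Ramsey number as a degree condition\<close>

lemma ramsey_C4_star_eq_Least: "ramsey_C4_star n = (LEAST N. forces_low_degree n N)"
proof -
  have "contains_copy (complement G) (star_graph n) \<longleftrightarrow>
      (\<exists>v\<in>verts G. card (nbhd G v) + n < card (verts G))"
    if G: "simple_graph G" for G :: "nat ugraph"
  proof -
    have "n \<le> card (nbhd (complement G) v) \<longleftrightarrow> card (nbhd G v) + n < card (verts G)"
      if "v \<in> verts G" for v
      using card_nbhd_complement[OF G that] by linarith
    moreover have "verts (complement G) = verts G"
      by (simp add: complement_def)
    ultimately show ?thesis
      using contains_star_iff[OF simple_graph_complement[OF G]] by auto
  qed
  then have "(\<forall>G :: nat ugraph. simple_graph G \<and> card (verts G) = N \<longrightarrow>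
      contains_copy G (cycle_graph 4) \<or> contains_copy (complement G) (star_graph n)) \<longleftrightarrow>
      forces_low_degree n N" for N
    unfolding forces_low_degree_def using contains_C4_iff by metis
  then show ?thesis
    by (simp add: ramsey_C4_star_def ramsey_number_def)
qed

text \<open>On \<open>2 n + 2\<close> vertices, two neighbourhoods of size at least \<open>n + 2\<close> overlap in two
  vertices, so some number has the property and \<open>LEAST\<close> is attained.\<close>

lemma forces_low_degree_exists: "forces_low_degree n (2 * n + 2)"
  unfolding forces_low_degree_def
proof (intro allI impI, rule ccontr)
  fix G :: "nat ugraph"
  assume G: "simple_graph G" and card: "card (verts G) = 2 * n + 2" and free: "C4_free G"
    and "\<not> (\<exists>v\<in>verts G. card (nbhd G v) + n < 2 * n + 2)"
  then have deg: "n + 2 \<le> card (nbhd G v)" if "v \<in> verts G" for v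
    using that by fastforce
  obtain X where "X \<subseteq> verts G" "card X = 2"
    using card obtain_subset_with_card_n[of 2 "verts G"] by auto
  then obtain a b where ab: "a \<in> verts G" "b \<in> verts G" "a \<noteq> b"
    by (auto simp: card_2_iff)
  have "card (nbhd G a \<union> nbhd G b) \<le> card (verts G)"
    using nbhd_subset[OF G] G by (intro card_mono) (auto simp: simple_graph_def)
  moreover have "card (nbhd G a \<union> nbhd G b) + card (nbhd G a \<inter> nbhd G b) =
      card (nbhd G a) + card (nbhd G b)"
    using card_Un_Int[OF finite_nbhd[OF G] finite_nbhd[OF G]] by simp
  ultimately have "2 \<le> card (nbhd G a \<inter> nbhd G b)"
    using deg[OF ab(1)] deg[OF ab(2)] card by linarith
  then show False
    using free ab by (fastforce simp: C4_free_def)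
qed

lemma forces_low_degree_ramsey: "forces_low_degree n (ramsey_C4_star n)"
  unfolding ramsey_C4_star_eq_Least using forces_low_degree_exists by (rule LeastI)

text \<open>The edgeless graph on \<open>N\<close> vertices shows this.\<close>

lemma forces_low_degree_less:
  assumes "forces_low_degree n N"
  shows "n < N"
proof -
  define G :: "nat ugraph" where "G = ({..<N}, {})"
  have "simple_graph G" "card (verts G) = N" "\<And>v. nbhd G v = {}"
    by (auto simp: simple_graph_def G_def nbhd_def)
  moreover from this have "C4_free G"
    by (simp add: C4_free_def)
  ultimately show ?thesis
    using assms unfolding forces_low_degree_def by fastforce
qed

section \<open>Deleting the closed neighbourhood of a vertex of minimum degree\<close>

text \<open>While all degrees exceed \<open>d\<close>, an edge can be deleted, and this lowers each
  degree by at most one.\<close>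

lemma exists_spanning_subgraph_min_degree:
  assumes "finite E" "simple_graph (V, E)" "V \<noteq> {}" "\<forall>v\<in>V. d \<le> card (nbhd (V, E) v)"
  shows "\<exists>F\<subseteq>E. (\<forall>v\<in>V. d \<le> card (nbhd (V, F) v)) \<and> (\<exists>v\<in>V. card (nbhd (V, F) v) = d)"
  using assms
proof (induction E rule: finite_psubset_induct)
  case (psubset E)
  show ?case
  proof (cases "\<exists>v\<in>V. card (nbhd (V, E) v) = d")
    case True
    then show ?thesis
      using psubset.prems by blast
  next
    case False
    then have gt: "d < card (nbhd (V, E) v)" if "v \<in> V" for v
      using psubset.prems(3) that by (metis le_neq_implies_less)
    then obtain a b where ab: "{a, b} \<in> E"
      using \<open>V \<noteq> {}\<close> by (fastforce simp: nbhd_def dest: card_ge_0_finite)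
    define F where "F = E - {{a, b}}"
    have "a \<noteq> b"
      using simple_graph_edgeD[OF psubset.prems(1)] ab by simp
    have "d \<le> card (nbhd (V, F) v)" if "v \<in> V" for v
    proof -
      have "nbhd (V, E) v - {if v = a then b else a} \<subseteq> nbhd (V, F) v"
        by (auto simp: nbhd_def F_def doubleton_eq_iff)
      moreover have "simple_graph (V, F)"
        using psubset.prems(1) by (auto simp: simple_graph_def F_def)
      ultimately have "card (nbhd (V, E) v - {if v = a then b else a}) \<le> card (nbhd (V, F) v)"
        by (intro card_mono finite_nbhd)
      then show ?thesis
        using gt[OF that] diff_card_le_card_Diff[of "{if v = a then b else a}" "nbhd (V, E) v"]
        by simp
    qed
    moreover have "F \<subset> E" "simple_graph (V, F)"
      using ab psubset.prems(1) by (auto simp: F_def simple_graph_def)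
    ultimately show ?thesis
      using psubset.IH[of F] \<open>V \<noteq> {}\<close> by blast
  qed
qed

text \<open>A vertex outside the closed neighbourhood of \<open>v\<close> loses only neighbours that it shares
  with \<open>v\<close>, and there is at most one of these.\<close>

lemma C4_free_delete_closed_nbhd:
  assumes G: "simple_graph G" and free: "C4_free G" and v: "v \<in> verts G"
  obtains H where "simple_graph H" "C4_free H" "verts H \<subseteq> verts G"
    "card (verts H) + card (nbhd G v) + 1 = card (verts G)"
    "\<And>w. w \<in> verts H \<Longrightarrow> card (nbhd G w) \<le> card (nbhd H w) + 1"
proof
  define W where "W = verts G - {v} - nbhd G v"
  define H where "H = (W, {e \<in> edges G. e \<subseteq> W})"
  show H: "simple_graph H"
    using G by (auto simp: simple_graph_def H_def W_def nsets_def)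
  show "C4_free H"
    using G free by (rule C4_free_mono) (auto simp: H_def)
  show "verts H \<subseteq> verts G"
    by (auto simp: H_def W_def)
  show "card (verts H) + card (nbhd G v) + 1 = card (verts G)"
    using card_nbhd_complement[OF G v] v by (simp add: H_def W_def nbhd_complement)
  fix w assume w: "w \<in> verts H"
  then have "w \<noteq> v" "v \<notin> nbhd G w"
    by (auto simp: H_def W_def nbhd_sym)
  have "nbhd G w \<subseteq> nbhd H w \<union> (nbhd G w \<inter> nbhd G v)"
    using w \<open>v \<notin> nbhd G w\<close> nbhd_subset[OF G, of w] by (auto simp: nbhd_def H_def W_def)
  then have "card (nbhd G w) \<le> card (nbhd H w \<union> (nbhd G w \<inter> nbhd G v))"
    by (intro card_mono) (auto simp: finite_nbhd G H)
  also have "\<dots> \<le> card (nbhd H w) + card (nbhd G w \<inter> nbhd G v)"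
    by (rule card_Un_le)
  also have "\<dots> \<le> card (nbhd H w) + 1"
    using free \<open>w \<noteq> v\<close> by (simp add: C4_free_def)
  finally show "card (nbhd G w) \<le> card (nbhd H w) + 1" .
qed

lemma forces_low_degree_step:
  assumes N: "forces_low_degree n N"
  shows "forces_low_degree (N + 1) (2 * N + 2 - n)"
  unfolding forces_low_degree_def
proof (intro allI impI, rule ccontr)
  fix G :: "nat ugraph"
  assume G: "simple_graph G" and card: "card (verts G) = 2 * N + 2 - n" and free: "C4_free G"
    and low: "\<not> (\<exists>v\<in>verts G. card (nbhd G v) + (N + 1) < 2 * N + 2 - n)"
  define d where "d = N - n + 1"
  have "n < N"
    using N by (rule forces_low_degree_less)
  then have deg: "\<forall>v\<in>verts G. d \<le> card (nbhd G v)"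
    using low by (fastforce simp: d_def)
  have fin: "finite (verts G)" and E: "edges G \<subseteq> nsets (verts G) 2"
    using G by (auto simp: simple_graph_def)
  have "finite (edges G)"
    using finite_subset[OF E] fin by (simp add: finite_imp_finite_nsets)
  moreover have "verts G \<noteq> {}"
    using card \<open>n < N\<close> by auto
  ultimately obtain F v where F: "F \<subseteq> edges G" "\<forall>v\<in>verts G. d \<le> card (nbhd (verts G, F) v)"
    and v: "v \<in> verts G" "card (nbhd (verts G, F) v) = d"
    using exists_spanning_subgraph_min_degree[of "edges G" "verts G" d] G deg by auto
  let ?F = "(verts G, F)"
  have "simple_graph ?F"
    using fin E F(1) by (auto simp: simple_graph_def)
  moreover have "C4_free ?F"
    using G free by (rule C4_free_mono) (simp add: F)
  ultimately obtain H where H: "simple_graph H" "C4_free H" "verts H \<subseteq> verts G"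
    and cardH: "card (verts H) + d + 1 = card (verts G)"
    and degH: "\<And>w. w \<in> verts H \<Longrightarrow> card (nbhd ?F w) \<le> card (nbhd H w) + 1"
    using C4_free_delete_closed_nbhd[of ?F v] v by auto
  have "card (verts H) = N"
    using cardH card \<open>n < N\<close> by (simp add: d_def)
  then obtain w where w: "w \<in> verts H" "card (nbhd H w) + n < N"
    using N H unfolding forces_low_degree_def by blast
  moreover have "d \<le> card (nbhd H w) + 1"
    using degH[OF w(1)] F(2) H(3) w(1) by fastforce
  ultimately show False
    using \<open>n < N\<close> by (simp add: d_def)
qed

theorem corollary8:
  fixes n :: nat
  assumes "n \<ge> 1"
  shows "int (ramsey_C4_star (ramsey_C4_star n + 1)) \<le> 2 * int (ramsey_C4_star n) - int n + 2"
proof -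
  let ?N = "ramsey_C4_star n"
  have N: "forces_low_degree n ?N"
    by (rule forces_low_degree_ramsey)
  have "ramsey_C4_star (?N + 1) \<le> 2 * ?N + 2 - n"
    unfolding ramsey_C4_star_eq_Least[of "?N + 1"]
    using forces_low_degree_step[OF N] by (rule Least_le)
  then show ?thesis
    using forces_low_degree_less[OF N] by linarith
qed

end
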